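(* Let $Q\subset\mathbb R^n$ be a nonempty bounded polyhedron with nonempty interior. For every (finite) subdivision $\mathcal T_1$ of $Q$ there exist constants $q,\rho\in(0,1)$ with $\rho\le\min_{T\in\mathcal T_1}\rho(T)$ such that the following refinement step can always be carried out, in every iteration $k=1,2,\dots$ and no matter which simplices $\bar T_k\in\mathcal T_k$ are selected for refinement: construct a subdivision $\mathcal T_{k+1}$ of $Q$ from $\mathcal T_k$ by a refinement of $\bar T_k$ such that $\operatorname{vol}(T)\le q\cdot\operatorname{vol}(\bar T_k)$ and $\rho(T)\ge\rho$ for all $T\in\mathcal T_{k+1}\setminus\mathcal T_k$. (That is, there is a refinement rule which, started from $\mathcal T_1$ and applied successively to arbitrarily selected simplices $\bar T_k\in\mathcal T_k$, always produces such $\mathcal T_{k+1}$.)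
   Context: A subdivision of $Q$ is a finite set of non-degenerate $n$-simplices whose union is $Q$ (hanging nodes are allowed). Refining $\bar T_k\in\mathcal T_k$ means replacing $\bar T_k$ by finitely many non-degenerate $n$-simplices whose union is $\bar T_k$, keeping all other simplices of $\mathcal T_k$. The aspect ratio of a simplex $T$ is $\rho(T):=\operatorname{diam}(B_T)/\operatorname{diam}(T)$, where $B_T$ is the largest ball contained in $T$; $\operatorname{vol}$ is $n$-dimensional Lebesgue measure. *)

theory Defs
  imports "HOL-Analysis.Analysis"
begin

(* "k simplex S" (library) means that S is the convex hull of k + 1 affinely independent
   points, so the simplices below are closed, full-dimensional and non-degenerate.
   Hanging nodes and overlaps are not excluded. *)

definition subdivision :: "(real ^ 'n) set \<Rightarrow> (real ^ 'n) set set \<Rightarrow> bool" where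
  "subdivision Q \<T> \<longleftrightarrow>
     finite \<T> \<and> (\<forall>T\<in>\<T>. int CARD('n) simplex T) \<and> \<Union>\<T> = Q"

(* Without S \<notin> \<R>, "replacing" S by {S} itself would count as a refinement with
   no new simplices. *)

definition refinement_of ::
  "(real ^ 'n) set set \<Rightarrow> (real ^ 'n) set \<Rightarrow> (real ^ 'n) set set \<Rightarrow> bool" where
  "refinement_of \<T> S \<T>' \<longleftrightarrow>
     S \<in> \<T> \<and> (\<exists>\<R>. subdivision S \<R> \<and> S \<notin> \<R> \<and> \<T>' = (\<T> - {S}) \<union> \<R>)"

definition is_largest_ball_in :: "(real ^ 'n) set \<Rightarrow> (real ^ 'n) set \<Rightarrow> bool" where
  "is_largest_ball_in B T \<longleftrightarrow>
     (\<exists>c r. 0 \<le> r \<and> B = cball c r \<and> cball c r \<subseteq> T \<and>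
            (\<forall>c' r'. cball c' r' \<subseteq> T \<longrightarrow> r' \<le> r))"

(* Any largest ball will do, as all of them have the same radius; existence in every nonempty
   compact set (hence in every simplex) is shown below. *)

definition aspect_ratio :: "(real ^ 'n) set \<Rightarrow> real" where
  "aspect_ratio T = diameter (SOME B. is_largest_ball_in B T) / diameter T"

lemma is_largest_ball_in_exists:
  fixes T :: "(real ^ 'n) set"
  assumes "compact T" "T \<noteq> {}"
  shows "\<exists>B. is_largest_ball_in B T"
proof -
  have cl: "closed T" and bd: "bounded T"
    using assms by (auto simp: compact_imp_closed compact_imp_bounded)
  have ne: "- T \<noteq> {}"
    using bd by (metis Compl_empty_eq double_compl not_bounded_UNIV)
  have "continuous_on T (\<lambda>c. infdist c (- T))"
    by (intro continuous_intros)
  then obtain c where c: "c \<in> T" "\<And>x. x \<in> T \<Longrightarrow> infdist x (- T) \<le> infdist c (- T)"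
    using continuous_attains_sup[OF assms] by blast
  let ?r = "infdist c (- T)"
  have "ball c ?r \<subseteq> T"
  proof
    fix x assume x: "x \<in> ball c ?r"
    show "x \<in> T"
    proof (rule ccontr)
      assume "x \<notin> T"
      then have "?r \<le> dist c x" by (intro infdist_le) auto
      then show False using x by auto
    qed
  qed
  then have sub: "cball c ?r \<subseteq> T"
    using cl c(1) infdist_nonneg[of c "- T"]
    by (cases "?r = 0") (auto simp flip: closure_ball intro: closure_minimal[THEN subsetD])
  have max: "r' \<le> ?r" if "cball c' r' \<subseteq> T" for c' r'
  proof (cases "r' < 0")
    case True
    then show ?thesis using infdist_nonneg[of c "- T"] by linarith
  next
    case False
    then have "c' \<in> T" using that by auto
    moreover have "r' \<le> infdist c' (- T)"
      unfolding infdist_notempty[OF ne] using that ne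
      by (intro cINF_greatest) (auto simp: subset_iff not_le intro: less_imp_le)
    ultimately show ?thesis using c(2) by force
  qed
  show ?thesis
    unfolding is_largest_ball_in_def using sub max infdist_nonneg by blast
qed

end

theory Submission
  imports Defs
begin

text \<open>
  The simplices of a subdivision may overlap, so a simplex can be refined by smaller copies of
  itself.  Shrink an \<open>n\<close>-simplex \<open>S\<close> towards each of its \<open>n + 1\<close> vertices by the factor
  \<open>t = n / (n + 1)\<close>.  In barycentric coordinates, the copy at the vertex \<open>v\<close> consists of the points
  of \<open>S\<close> whose coordinate at \<open>v\<close> is at least \<open>1 - t = 1 / (n + 1)\<close>.  As the \<open>n + 1\<close> coordinates of a
  point sum to 1, one of them is that large, and the copies cover \<open>S\<close>
  (\<open>convex_hull_eq_Union_shrunken_copies\<close>).  Every copy is homothetic to \<open>S\<close>, so it has the aspect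
  ratio of \<open>S\<close> (\<open>aspect_ratio_affinity\<close>) and \<open>t ^ n\<close> times its volume.

  Therefore \<open>q = t ^ n\<close> works, and no simplex that ever arises has a smaller aspect ratio than the
  worst simplex of the initial subdivision, whatever simplices are selected.  That minimum can be 1
  (in dimension one every aspect ratio is 1), so \<open>\<rho>\<close> is the smaller of it and \<open>1/2\<close>.
\<close>

section \<open>Homothetic images\<close>

lemma affinity_cball:
  fixes a c :: "'a::real_normed_vector"
  assumes "0 < t"
  shows "(\<lambda>x. t *\<^sub>R x + c) ` cball a r = cball (t *\<^sub>R a + c) (t * r)"
proof -
  have scaled: "(*\<^sub>R) t ` cball a r = cball (t *\<^sub>R a) (t * r)"
    using cball_scale[of t a r] assms by simp
  have "(\<lambda>x. t *\<^sub>R x + c) ` cball a r = (+) c ` (*\<^sub>R) t ` cball a r"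
    by (simp add: image_image add.commute)
  also have "\<dots> = cball (t *\<^sub>R a + c) (t * r)"
    using cball_translation[of c "t *\<^sub>R a" "t * r"] by (simp only: scaled add.commute)
  finally show ?thesis .
qed

lemma affinity_inverse:
  fixes c :: "'a::real_vector"
  assumes "t \<noteq> 0"
  shows "(\<lambda>x. (1 / t) *\<^sub>R x + (- (1 / t)) *\<^sub>R c) ` (\<lambda>x. t *\<^sub>R x + c) ` S = S"
  using assms by (simp add: image_image scaleR_add_right)

lemma diameter_affinity:
  fixes c :: "'a::real_normed_vector"
  assumes "bounded S" and "0 < t"
  shows "diameter ((\<lambda>x. t *\<^sub>R x + c) ` S) = t * diameter S"
proof -
  have le: "diameter ((\<lambda>x. u *\<^sub>R x + d) ` A) \<le> u * diameter A"
    if "bounded A" "0 < u" for u d and A :: "'a set"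
  proof (rule diameter_le)
    show "(\<lambda>x. u *\<^sub>R x + d) ` A \<noteq> {} \<or> 0 \<le> u * diameter A"
      using that by (simp add: diameter_ge_0)
    fix y z assume "y \<in> (\<lambda>x. u *\<^sub>R x + d) ` A" "z \<in> (\<lambda>x. u *\<^sub>R x + d) ` A"
    then obtain y' z' where "y' \<in> A" "z' \<in> A" "y - z = u *\<^sub>R (y' - z')"
      by (auto simp: scaleR_diff_right)
    then show "norm (y - z) \<le> u * diameter A"
      using that diameter_bounded_bound[of A y' z'] by (simp add: dist_norm)
  qed
  have "bounded ((\<lambda>x. t *\<^sub>R x + c) ` S)"
    using bounded_translation[OF bounded_scaling[OF assms(1)], of c t]
    by (simp add: image_image add.commute)
  then have "diameter S \<le> (1 / t) * diameter ((\<lambda>x. t *\<^sub>R x + c) ` S)"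
    using le[of "(\<lambda>x. t *\<^sub>R x + c) ` S" "1 / t" "(- (1 / t)) *\<^sub>R c"] assms(2)
      affinity_inverse[of t c S] by simp
  then show ?thesis
    using le[OF assms, of c] assms(2) by (simp add: field_simps)
qed

lemma simplex_affinity:
  fixes S :: "'a::euclidean_space set"
  assumes "k simplex S" and "t \<noteq> 0"
  shows "k simplex ((\<lambda>x. t *\<^sub>R x + c) ` S)"
proof -
  obtain C where C: "\<not> affine_dependent C" "int (card C) = k + 1" "S = convex hull C"
    using assms(1) unfolding simplex_def by blast
  let ?f = "\<lambda>x. t *\<^sub>R x + c"
  have card: "card (?f ` C) = card C"
    using assms(2) by (intro card_image) (auto simp: inj_on_def)
  have "?f ` C = (+) c ` (*\<^sub>R) t ` C"
    by (simp add: image_image add.commute)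
  then have "aff_dim (?f ` C) = aff_dim ((*\<^sub>R) t ` C)"
    by (simp add: aff_dim_translation_eq)
  also have "\<dots> = aff_dim C"
    using assms(2) by (intro aff_dim_injective_linear_image) (auto simp: inj_def)
  finally have "\<not> affine_dependent (?f ` C)"
    using C(1) card by (simp add: affine_independent_iff_card)
  moreover have "?f ` S = convex hull (?f ` C)"
    using C(3) convex_hull_affinity[of c t C] by (simp add: add.commute)
  ultimately show ?thesis
    using C(2) card unfolding simplex_def by metis
qed

section \<open>Aspect ratio\<close>

lemma aspect_ratio_eq:
  assumes "cball c r \<subseteq> T" and "0 \<le> r" and "\<And>c' r'. cball c' r' \<subseteq> T \<Longrightarrow> r' \<le> r"
  shows "aspect_ratio T = 2 * r / diameter T"
proof -
  have "is_largest_ball_in (cball c r) T"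
    using assms unfolding is_largest_ball_in_def by blast
  then have "is_largest_ball_in (SOME B. is_largest_ball_in B T) T"
    by (rule someI)
  then obtain c' r' where B: "(SOME B. is_largest_ball_in B T) = cball c' r'" "0 \<le> r'"
    "cball c' r' \<subseteq> T" and max: "\<And>c'' r''. cball c'' r'' \<subseteq> T \<Longrightarrow> r'' \<le> r'"
    unfolding is_largest_ball_in_def by blast
  have "r' = r"
    using assms(3)[OF B(3)] max[OF assms(1)] by simp
  then show ?thesis
    using B by (simp add: aspect_ratio_def)
qed

lemma obtain_largest_ball:
  fixes T :: "(real ^ 'n) set"
  assumes "compact T" and "T \<noteq> {}"
  obtains c r where "cball c r \<subseteq> T" and "0 \<le> r" and "\<And>c' r'. cball c' r' \<subseteq> T \<Longrightarrow> r' \<le> r"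
  using is_largest_ball_in_exists[OF assms] unfolding is_largest_ball_in_def by blast

text \<open>A homothety maps largest balls to largest balls: a larger ball in the image could be pulled
  back.  The factor then cancels between the two diameters.\<close>
lemma aspect_ratio_affinity:
  fixes T :: "(real ^ 'n) set"
  assumes "compact T" and "T \<noteq> {}" and "0 < t"
  shows "aspect_ratio ((\<lambda>x. t *\<^sub>R x + c) ` T) = aspect_ratio T"
proof -
  let ?f = "\<lambda>x. t *\<^sub>R x + c"
  obtain a r where ball: "cball a r \<subseteq> T" "0 \<le> r" and max: "\<And>c' r'. cball c' r' \<subseteq> T \<Longrightarrow> r' \<le> r"
    using obtain_largest_ball[OF assms(1,2)] by blast
  have "aspect_ratio (?f ` T) = 2 * (t * r) / diameter (?f ` T)"
  proof (rule aspect_ratio_eq)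
    show "cball (t *\<^sub>R a + c) (t * r) \<subseteq> ?f ` T"
      using image_mono[OF ball(1), of ?f] assms(3) by (simp add: affinity_cball)
    show "0 \<le> t * r"
      using assms(3) ball(2) by simp
    fix c' r' assume "cball c' r' \<subseteq> ?f ` T"
    from image_mono[OF this, of "\<lambda>x. (1 / t) *\<^sub>R x + (- (1 / t)) *\<^sub>R c"]
    have "cball ((1 / t) *\<^sub>R c' + (- (1 / t)) *\<^sub>R c) ((1 / t) * r') \<subseteq> T"
      using assms(3) affinity_cball[of "1 / t" "(- (1 / t)) *\<^sub>R c" c' r']
      by (simp only: affinity_inverse) simp
    from max[OF this] show "r' \<le> t * r"
      using assms(3) by (simp add: field_simps)
  qed
  also have "\<dots> = 2 * r / diameter T"
    using assms by (simp add: diameter_affinity compact_imp_bounded)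
  also have "\<dots> = aspect_ratio T"
    using aspect_ratio_eq[OF ball max] by simp
  finally show ?thesis .
qed

lemma interior_full_dimensional_simplex:
  fixes S :: "'a::euclidean_space set"
  assumes "int DIM('a) simplex S"
  shows "interior S \<noteq> {}"
proof -
  have "S \<noteq> {}"
    using assms by auto
  then have "rel_interior S \<noteq> {}"
    using assms by (simp add: rel_interior_eq_empty convex_simplex)
  moreover have "affine hull S = UNIV"
    using aff_dim_simplex[OF assms] by (simp add: aff_dim_eq_full)
  ultimately show ?thesis
    by (simp add: rel_interior_interior)
qed

lemma diameter_pos_if_interior:
  fixes S :: "'a::euclidean_space set"
  assumes "bounded S" and "interior S \<noteq> {}"
  shows "0 < diameter S"
proof -
  obtain a e where "0 < e" "cball a e \<subseteq> S"
    using assms(2) by (auto simp: mem_interior_cball)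
  then show ?thesis
    using diameter_subset[of "cball a e" S] assms(1) by simp
qed

lemma aspect_ratio_pos:
  fixes T :: "(real ^ 'n) set"
  assumes "compact T" and "interior T \<noteq> {}"
  shows "0 < aspect_ratio T"
proof -
  obtain a r where ball: "cball a r \<subseteq> T" "0 \<le> r" and max: "\<And>c' r'. cball c' r' \<subseteq> T \<Longrightarrow> r' \<le> r"
    using obtain_largest_ball[OF assms(1)] assms(2) by (metis interior_empty)
  obtain b e where "0 < e" "cball b e \<subseteq> T"
    using assms(2) by (auto simp: mem_interior_cball)
  then have "0 < r"
    using max by fastforce
  then show ?thesis
    using aspect_ratio_eq[OF ball max] diameter_pos_if_interior[of T] assms
    by (simp add: compact_imp_bounded)
qed

section \<open>Covering a simplex by shrunken copies\<close>

text \<open>Subtracting \<open>1 - t\<close> from a barycentric coordinate that is at least the average \<open>1 / card C\<close>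
  leaves nonnegative coordinates of sum \<open>t\<close>; divided by \<open>t\<close>, they give the preimage of the point
  under the contraction towards the corresponding vertex.\<close>
lemma convex_hull_eq_Union_shrunken_copies:
  fixes C :: "'a::real_vector set"
  assumes C: "finite C" "C \<noteq> {}" and t: "0 < t" "t \<le> 1" "1 - t \<le> 1 / real (card C)"
  shows "(\<Union>v\<in>C. (\<lambda>x. t *\<^sub>R x + (1 - t) *\<^sub>R v) ` (convex hull C)) = convex hull C"
    (is "?L = ?R")
proof
  have "t *\<^sub>R x + (1 - t) *\<^sub>R v \<in> ?R" if "v \<in> C" "x \<in> ?R" for v x
    using that t convex_convex_hull[of C] by (intro convexD) (auto simp: hull_inc)
  then show "?L \<subseteq> ?R" by blast
next
  show "?R \<subseteq> ?L"
  proof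
    fix x assume "x \<in> ?R"
    then obtain u where u: "\<And>v. v \<in> C \<Longrightarrow> 0 \<le> u v" "sum u C = 1" and x: "(\<Sum>v\<in>C. u v *\<^sub>R v) = x"
      using C(1) by (auto simp: convex_hull_finite)
    have "\<exists>w\<in>C. 1 / real (card C) \<le> u w"
    proof (rule ccontr)
      assume "\<not> (\<exists>w\<in>C. 1 / real (card C) \<le> u w)"
      then have "sum u C < (\<Sum>v\<in>C. 1 / real (card C))"
        using C by (intro sum_strict_mono) (auto simp: not_le)
      then show False
        using C u(2) by simp
    qed
    then obtain w where w: "w \<in> C" "1 - t \<le> u w"
      using t(3) by force
    define u' where "u' v = (u v - (if v = w then 1 - t else 0)) / t" for v
    have "0 \<le> u' v" if "v \<in> C" for v
      using that u(1) w(2) t(1) by (simp add: u'_def)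
    moreover have "sum u' C = 1"
      using C(1) w(1) u(2) t(1)
      by (simp add: u'_def sum_subtractf flip: sum_divide_distrib)
    ultimately have y: "(\<Sum>v\<in>C. u' v *\<^sub>R v) \<in> ?R"
      using C(1) by (auto simp: convex_hull_finite)
    have "t *\<^sub>R (\<Sum>v\<in>C. u' v *\<^sub>R v) = (\<Sum>v\<in>C. u v *\<^sub>R v - (if v = w then (1 - t) *\<^sub>R v else 0))"
      unfolding scaleR_sum_right
      using t(1) by (intro sum.cong) (auto simp: u'_def scaleR_diff_left)
    also have "\<dots> = x - (1 - t) *\<^sub>R w"
      using C(1) w(1) x by (simp add: sum_subtractf)
    finally have "x = t *\<^sub>R (\<Sum>v\<in>C. u' v *\<^sub>R v) + (1 - t) *\<^sub>R w"
      by simp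
    then show "x \<in> ?L"
      using y w(1) by blast
  qed
qed

text \<open>The vertices are taken as the extreme points, so that the copies depend on the set \<open>S\<close> alone
  and not on a chosen representation as a convex hull.\<close>
definition corner_copies :: "real \<Rightarrow> 'a::euclidean_space set \<Rightarrow> 'a set set" where
  "corner_copies t S = (\<lambda>v. (\<lambda>x. t *\<^sub>R x + (1 - t) *\<^sub>R v) ` S) ` {v. v extreme_point_of S}"

lemma subdivision_corner_copies:
  fixes S :: "(real ^ 'n) set"
  assumes S: "int CARD('n) simplex S"
    and t: "0 < t" "t \<le> 1" "1 - t \<le> 1 / (real CARD('n) + 1)"
  shows "subdivision S (corner_copies t S)"
proof -
  obtain C where C: "\<not> affine_dependent C" "int (card C) = int CARD('n) + 1" "S = convex hull C"
    using S unfolding simplex_def by blast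
  have fin: "finite C" and card: "card C = CARD('n) + 1"
    using C(1,2) aff_independent_finite by auto
  then have "C \<noteq> {}" by auto
  have extreme: "{v. v extreme_point_of S} = C"
    using C(1,3) by (auto simp: extreme_point_of_convex_hull_affine_independent)
  have "\<Union> (corner_copies t S) = S"
    unfolding corner_copies_def extreme unfolding C(3)
    using convex_hull_eq_Union_shrunken_copies[OF fin \<open>C \<noteq> {}\<close> t(1,2)] t(3) card
    by (simp add: add.commute)
  moreover have "\<forall>T\<in>corner_copies t S. int CARD('n) simplex T"
    using t(1) S by (auto simp: corner_copies_def intro: simplex_affinity)
  ultimately show ?thesis
    using fin unfolding subdivision_def by (simp add: corner_copies_def extreme)
qed

section \<open>The refinement rule\<close>

lemma subdivision_refinement:
  assumes "subdivision Q \<T>" and "refinement_of \<T> S \<T>'"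
  shows "subdivision Q \<T>'"
  using assms unfolding subdivision_def refinement_of_def by blast

text \<open>The copies differ from \<open>S\<close> because their diameter is smaller, so that they do replace it.\<close>
lemma refinement_of_corner_copies:
  fixes S :: "(real ^ 'n) set"
  assumes "S \<in> \<T>" and S: "int CARD('n) simplex S"
    and t: "0 < t" "t < 1" "1 - t \<le> 1 / (real CARD('n) + 1)"
  shows "refinement_of \<T> S ((\<T> - {S}) \<union> corner_copies t S)"
proof -
  have "bounded S"
    using S by (simp add: compact_imp_bounded compact_simplex)
  moreover have "0 < diameter S"
    using \<open>bounded S\<close> S interior_full_dimensional_simplex[of S]
    by (simp add: diameter_pos_if_interior)
  ultimately have "diameter T < diameter S" if "T \<in> corner_copies t S" for T
    using that t by (auto simp: corner_copies_def diameter_affinity)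
  then have "S \<notin> corner_copies t S"
    by blast
  then show ?thesis
    using assms(1) subdivision_corner_copies[OF S t(1) _ t(3)] t(2)
    unfolding refinement_of_def by (auto intro!: exI[of _ "corner_copies t S"])
qed

theorem lemma3p2:
  fixes Q :: "(real ^ 'n) set" and \<T>\<^sub>1 :: "(real ^ 'n) set set"
  assumes "polyhedron Q" and "bounded Q" and "Q \<noteq> {}" and "interior Q \<noteq> {}"
    and "subdivision Q \<T>\<^sub>1"
  shows "\<exists>q \<rho>. 0 < q \<and> q < 1 \<and> 0 < \<rho> \<and> \<rho> < 1 \<and> \<rho> \<le> Min (aspect_ratio ` \<T>\<^sub>1) \<and>
    (\<exists>refine :: (real ^ 'n) set set \<Rightarrow> (real ^ 'n) set \<Rightarrow> (real ^ 'n) set set.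
      \<forall>(\<T> :: nat \<Rightarrow> (real ^ 'n) set set) (S :: nat \<Rightarrow> (real ^ 'n) set).
        \<T> 1 = \<T>\<^sub>1 \<longrightarrow> (\<forall>k\<ge>1. \<T> (k + 1) = refine (\<T> k) (S k)) \<longrightarrow>
        (\<forall>k\<ge>1. (\<forall>j\<in>{1..k}. S j \<in> \<T> j) \<longrightarrow>
          subdivision Q (\<T> (k + 1)) \<and> refinement_of (\<T> k) (S k) (\<T> (k + 1)) \<and>
          (\<forall>T \<in> \<T> (k + 1) - \<T> k.
             measure lebesgue T \<le> q * measure lebesgue (S k) \<and> aspect_ratio T \<ge> \<rho>)))"

proof -
  let ?n = "CARD('n)"
  let ?t = "real ?n / (real ?n + 1)"
  let ?q = "?t ^ ?n"
  define \<rho> where "\<rho> = min (1/2) (Min (aspect_ratio ` \<T>\<^sub>1))"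
  have t: "0 < ?t" "?t < 1" "1 - ?t \<le> 1 / (real ?n + 1)"
    by (auto simp: field_simps)
  have q: "0 < ?q" "?q < 1"
    using t by (auto simp: power_less_one_iff)
  have \<T>\<^sub>1: "finite \<T>\<^sub>1" "\<T>\<^sub>1 \<noteq> {}" "\<And>T. T \<in> \<T>\<^sub>1 \<Longrightarrow> int ?n simplex T"
    using assms(3,5) unfolding subdivision_def by auto
  have "0 < aspect_ratio T" if "T \<in> \<T>\<^sub>1" for T
    using \<T>\<^sub>1(3)[OF that] interior_full_dimensional_simplex[of T]
    by (simp add: aspect_ratio_pos compact_simplex)
  then have \<rho>: "0 < \<rho>" "\<rho> < 1" "\<rho> \<le> Min (aspect_ratio ` \<T>\<^sub>1)"
    using \<T>\<^sub>1(1,2) by (auto simp: \<rho>_def)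
  define refine where "refine \<T> S = (\<T> - {S}) \<union> corner_copies ?t S"
    for \<T> :: "(real ^ 'n) set set" and S
  have aspect_copy: "aspect_ratio T = aspect_ratio S"
    if "T \<in> corner_copies ?t S" "int ?n simplex S" for S T :: "(real ^ 'n) set"
  proof -
    have "compact S" "S \<noteq> {}"
      using that(2) compact_simplex by auto
    then show ?thesis
      using that(1) aspect_ratio_affinity[OF _ _ t(1), of S] unfolding corner_copies_def by blast
  qed
  have volume_copy: "measure lebesgue T = ?q * measure lebesgue S"
    if "T \<in> corner_copies ?t S" for S T :: "(real ^ 'n) set"
    using that by (auto simp: corner_copies_def measure_lebesgue_affine)
  have good: "subdivision Q (\<T> k) \<and> (\<forall>T\<in>\<T> k. \<rho> \<le> aspect_ratio T)"
    if "\<T> 1 = \<T>\<^sub>1" "\<forall>k\<ge>1. \<T> (k + 1) = refine (\<T> k) (S k)" "1 \<le> k" "\<forall>j\<in>{1..<k}. S j \<in> \<T> j"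
    for \<T> S and k :: nat
    using that(3,4)
  proof (induction k rule: dec_induct)
    case base
    have "\<rho> \<le> aspect_ratio T" if "T \<in> \<T>\<^sub>1" for T
      using \<rho>(3) \<T>\<^sub>1(1) that by (meson Min_le finite_imageI imageI order_trans)
    then show ?case
      using assms(5) that(1) by simp
  next
    case (step k)
    then have IH: "subdivision Q (\<T> k)" "\<forall>T\<in>\<T> k. \<rho> \<le> aspect_ratio T" and "S k \<in> \<T> k"
      by auto
    have simplex: "int ?n simplex S k"
      using IH(1) \<open>S k \<in> \<T> k\<close> by (simp add: subdivision_def)
    have eq: "\<T> (Suc k) = refine (\<T> k) (S k)"
      using that(2) step.hyps by simp
    then have "refinement_of (\<T> k) (S k) (\<T> (Suc k))"
      using refinement_of_corner_copies[OF \<open>S k \<in> \<T> k\<close> simplex t] by (simp add: refine_def)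
    moreover have "\<forall>T\<in>\<T> (Suc k). \<rho> \<le> aspect_ratio T"
      using IH(2) \<open>S k \<in> \<T> k\<close> aspect_copy[OF _ simplex] by (auto simp: eq refine_def)
    ultimately show ?case
      using subdivision_refinement IH(1) by blast
  qed
  have "\<forall>(\<T> :: nat \<Rightarrow> (real ^ 'n) set set) S.
        \<T> 1 = \<T>\<^sub>1 \<longrightarrow> (\<forall>k\<ge>1. \<T> (k + 1) = refine (\<T> k) (S k)) \<longrightarrow>
        (\<forall>k\<ge>1. (\<forall>j\<in>{1..k}. S j \<in> \<T> j) \<longrightarrow>
          subdivision Q (\<T> (k + 1)) \<and> refinement_of (\<T> k) (S k) (\<T> (k + 1)) \<and>
          (\<forall>T \<in> \<T> (k + 1) - \<T> k.
             measure lebesgue T \<le> ?q * measure lebesgue (S k) \<and> aspect_ratio T \<ge> \<rho>))"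
  proof (intro allI impI)
    fix \<T> :: "nat \<Rightarrow> (real ^ 'n) set set" and S k
    assume run: "\<T> 1 = \<T>\<^sub>1" "\<forall>k\<ge>1. \<T> (k + 1) = refine (\<T> k) (S k)"
      and "1 \<le> k" and sel: "\<forall>j\<in>{1..k}. S j \<in> \<T> j"
    have "S k \<in> \<T> k"
      using sel \<open>1 \<le> k\<close> by simp
    have "subdivision Q (\<T> k)"
      using good[OF run \<open>1 \<le> k\<close>] sel by simp
    then have simplex: "int ?n simplex S k"
      using \<open>S k \<in> \<T> k\<close> by (simp add: subdivision_def)
    have eq: "\<T> (k + 1) = (\<T> k - {S k}) \<union> corner_copies ?t (S k)"
      using run(2) \<open>1 \<le> k\<close> by (simp add: refine_def)
    have next_good: "subdivision Q (\<T> (k + 1)) \<and> (\<forall>T\<in>\<T> (k + 1). \<rho> \<le> aspect_ratio T)"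
      using sel by (intro good[OF run]) auto
    have "measure lebesgue T \<le> ?q * measure lebesgue (S k)" if "T \<in> \<T> (k + 1) - \<T> k" for T
      using that volume_copy[of T "S k"] unfolding eq by auto
    then show "subdivision Q (\<T> (k + 1)) \<and> refinement_of (\<T> k) (S k) (\<T> (k + 1)) \<and>
        (\<forall>T \<in> \<T> (k + 1) - \<T> k.
           measure lebesgue T \<le> ?q * measure lebesgue (S k) \<and> aspect_ratio T \<ge> \<rho>)"
      using next_good refinement_of_corner_copies[OF \<open>S k \<in> \<T> k\<close> simplex t]
      unfolding eq by blast
  qed
  then show ?thesis
    using q \<rho> by blast
qed

end
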